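(* Let $k > 2$ be an integer and let $\varepsilon > 0$ be a real number. Then there exists $d_0 > 0$ such that for every integer $d \geq d_0$, every finite $d$-regular linear $k$-graph $H$ and every vertex $v \in V(H)$, $$\frac{1}{d+1} \leq \mathcal{P}_H(\overline{v}) < 1 - \frac{1 - \varepsilon}{d^{k-2}}.$$
   Context: A $k$-graph is a $k$-uniform hypergraph. It is linear if any two distinct edges share at most one vertex, and $d$-regular if every vertex lies in exactly $d$ edges. A matching is a set of pairwise vertex-disjoint edges; the empty set is a matching. For a finite $k$-graph $H$, let $M$ be a matching chosen uniformly at random from the set of all matchings of $H$. For $v \in V(H)$, $\mathcal{P}_H(\overline{v})$ denotes the probability that no edge of $M$ contains $v$. *)

theory Defs
  imports "HOL-Probability.Probability" "HOL-Library.Disjoint_Sets"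
begin

definition kgraph :: "nat \<Rightarrow> 'a set \<Rightarrow> 'a set set \<Rightarrow> bool" where
  "kgraph k V E \<longleftrightarrow> (\<forall>e\<in>E. e \<subseteq> V \<and> card e = k)"

definition linear_hypergraph :: "'a set set \<Rightarrow> bool" where
  "linear_hypergraph E \<longleftrightarrow> (\<forall>e\<in>E. \<forall>f\<in>E. e \<noteq> f \<longrightarrow> card (e \<inter> f) \<le> 1)"

definition regular_hypergraph :: "nat \<Rightarrow> 'a set \<Rightarrow> 'a set set \<Rightarrow> bool" where
  "regular_hypergraph d V E \<longleftrightarrow> (\<forall>v\<in>V. card {e\<in>E. v \<in> e} = d)"

definition matchings :: "'a set set \<Rightarrow> 'a set set set" where
  "matchings E = {M. M \<subseteq> E \<and> disjoint M}"

definition prob_uncovered :: "'a set set \<Rightarrow> 'a \<Rightarrow> real" where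
  "prob_uncovered E v = measure_pmf.prob (pmf_of_set (matchings E)) {M. \<forall>e\<in>M. v \<notin> e}"

text \<open>The uniform distribution \<^const>\<open>pmf_of_set\<close> is only meaningful on finite
  nonempty sets; the next two facts give this for the matchings of a finite hypergraph.\<close>

lemma finite_matchings:
  assumes "finite V" "kgraph k V E"
  shows "finite (matchings E)"
proof -
  have "E \<subseteq> Pow V" using assms(2) by (auto simp: kgraph_def)
  then have "finite E" using assms(1) by (meson finite_Pow_iff finite_subset)
  then show ?thesis by (simp add: matchings_def)
qed

lemma matchings_nonempty: "matchings E \<noteq> {}"
proof -
  have "{} \<in> matchings E" by (simp add: matchings_def)
  then show ?thesis by blast
qed

end

theory Submission
  imports Defs "HOL-Real_Asymp.Real_Asymp"
begin

text \<open>
  Write \<open>Z(U)\<close> for the number of matchings all of whose edges avoid the vertex set \<open>U\<close>.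
  Sorting the matchings by the edge that covers \<open>v\<close> gives
  \<open>Z({}) = Z({v}) + (\<Sum>e\<ni>v. Z(e))\<close>. Since \<open>Z(e) \<le> Z({v})\<close>, this yields
  \<open>Z({}) \<le> (d + 1) Z({v})\<close>, which is the lower bound. Applying the same inequality successively to
  the other \<open>k - 1\<close> vertices of an edge \<open>e \<ni> v\<close> gives \<open>Z({v}) \<le> (d + 1)\<^sup>k\<^sup>-\<^sup>1 Z(e)\<close>, and summing
  over the \<open>d\<close> edges at \<open>v\<close> bounds the odds of \<open>v\<close> being covered from below by
  \<open>d / (d + 1)\<^sup>k\<^sup>-\<^sup>1\<close>.
\<close>

text \<open>This is deletion of the vertices in \<open>U\<close>, kept as an edge set alone because
  \<open>matchings\<close> refers only to edges.\<close>

definition avoiding :: "'a set set \<Rightarrow> 'a set \<Rightarrow> 'a set set" where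
  "avoiding E U = {e\<in>E. e \<inter> U = {}}"

lemma avoiding_subset: "avoiding E U \<subseteq> E"
  by (auto simp: avoiding_def)

lemma avoiding_empty [simp]: "avoiding E {} = E"
  by (auto simp: avoiding_def)

lemma avoiding_avoiding: "avoiding (avoiding E U) W = avoiding E (U \<union> W)"
  by (auto simp: avoiding_def)

lemma finite_matchings_edges: "finite E \<Longrightarrow> finite (matchings E)"
  by (simp add: matchings_def)

lemma card_matchings_pos: "finite E \<Longrightarrow> 0 < card (matchings E)"
  by (simp add: card_gt_0_iff finite_matchings_edges matchings_nonempty)

lemma card_matchings_mono:
  assumes "finite F" "E \<subseteq> F"
  shows "card (matchings E) \<le> card (matchings F)"
  using assms by (intro card_mono finite_matchings_edges) (auto simp: matchings_def)

lemma matchings_uncovered: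
  "{M\<in>matchings E. \<forall>e\<in>M. v \<notin> e} = matchings (avoiding E {v})"
  by (auto simp: matchings_def avoiding_def)

text \<open>Removing \<open>e\<close> is a bijection whose inverse inserts \<open>e\<close>: the
  other edges of a matching containing \<open>e\<close> are exactly those disjoint from
  \<open>e\<close>. The vertex \<open>v\<close> makes \<open>e\<close> nonempty, so \<open>e\<close>
  itself is not in \<open>avoiding E e\<close>.\<close>

lemma card_matchings_containing:
  assumes "e \<in> E" "v \<in> e"
  shows "card {M\<in>matchings E. e \<in> M} = card (matchings (avoiding E e))"
proof (rule bij_betw_same_card[of "\<lambda>M. M - {e}"], rule bij_betw_byWitness[where f' = "insert e"])
  show "\<forall>M\<in>matchings (avoiding E e). insert e M - {e} = M"
    using assms by (auto simp: matchings_def avoiding_def)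
  show "(\<lambda>M. M - {e}) ` {M\<in>matchings E. e \<in> M} \<subseteq> matchings (avoiding E e)"
    by (auto simp: matchings_def avoiding_def pairwise_def disjnt_def)
  show "insert e ` matchings (avoiding E e) \<subseteq> {M\<in>matchings E. e \<in> M}"
    using assms(1) unfolding matchings_def avoiding_def disjoint_def by blast
qed auto

lemma card_matchings_split_at_vertex:
  assumes "finite E"
  shows "card (matchings E) = card (matchings (avoiding E {v}))
           + (\<Sum>e\<in>{e\<in>E. v \<in> e}. card (matchings (avoiding E e)))"
proof -
  let ?C = "\<lambda>e. {M\<in>matchings E. e \<in> M}"
  let ?D = "{e\<in>E. v \<in> e}"
  have fin: "finite (matchings E)" using assms by (rule finite_matchings_edges)
  have "matchings E = matchings (avoiding E {v}) \<union> (\<Union>e\<in>?D. ?C e)"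
    unfolding matchings_uncovered[symmetric] by (auto simp: matchings_def)
  moreover have "matchings (avoiding E {v}) \<inter> (\<Union>e\<in>?D. ?C e) = {}"
    unfolding matchings_uncovered[symmetric] by auto
  moreover have "card (\<Union>e\<in>?D. ?C e) = (\<Sum>e\<in>?D. card (?C e))"
  proof (rule card_UN_disjoint)
    \<comment> \<open>Distinct edges through \<open>v\<close> meet in \<open>v\<close>, so no
      matching contains both.\<close>
    show "\<forall>e\<in>?D. \<forall>f\<in>?D. e \<noteq> f \<longrightarrow> ?C e \<inter> ?C f = {}"
      unfolding matchings_def disjoint_def by blast
  qed (use assms fin in auto)
  ultimately have "card (matchings E) = card (matchings (avoiding E {v})) + (\<Sum>e\<in>?D. card (?C e))"
    using fin by (metis (no_types, lifting) card_Un_disjoint finite_Un)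
  also have "(\<Sum>e\<in>?D. card (?C e)) = (\<Sum>e\<in>?D. card (matchings (avoiding E e)))"
    by (intro sum.cong refl card_matchings_containing[where v = v]) auto
  finally show ?thesis .
qed

text \<open>For \<open>v \<in> e\<close>, \<open>avoiding E e\<close> lies inside
  \<open>avoiding E {v}\<close>, which bounds each of the at most \<open>d\<close> summands of the
  split. Assuming only a degree bound keeps the lemma applicable after vertex deletions, which can
  destroy regularity.\<close>

lemma card_matchings_le_avoiding_vertex:
  assumes "finite E" "card {e\<in>E. v \<in> e} \<le> d"
  shows "card (matchings E) \<le> (d + 1) * card (matchings (avoiding E {v}))"
proof -
  have "(\<Sum>e\<in>{e\<in>E. v \<in> e}. card (matchings (avoiding E e)))
      \<le> of_nat (card {e\<in>E. v \<in> e}) * card (matchings (avoiding E {v}))"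
    by (intro sum_bounded_above card_matchings_mono finite_subset[OF avoiding_subset assms(1)])
       (auto simp: avoiding_def)
  also have "\<dots> \<le> d * card (matchings (avoiding E {v}))"
    using assms(2) by simp
  finally show ?thesis
    using card_matchings_split_at_vertex[OF assms(1), of v] by simp
qed

text \<open>The vertices of \<open>U\<close> are deleted one at a time, each at the cost of a factor
  \<open>d + 1\<close>; degrees never grow when edges are removed, so the bound \<open>d\<close>
  persists.\<close>

lemma card_matchings_le_avoiding:
  assumes "finite E" "finite U" "\<And>u. u \<in> U \<Longrightarrow> card {e\<in>E. u \<in> e} \<le> d"
  shows "card (matchings E) \<le> (d + 1) ^ card U * card (matchings (avoiding E U))"
  using assms(2,3)
proof (induction U)
  case (insert u U)
  let ?F = "avoiding E U"
  have finF: "finite ?F" using assms(1) avoiding_subset by (rule finite_subset[rotated])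
  have "card {e\<in>?F. u \<in> e} \<le> card {e\<in>E. u \<in> e}"
    using assms(1) avoiding_subset[of E U] by (intro card_mono) auto
  also have "\<dots> \<le> d" using insert.prems by simp
  finally have "card (matchings ?F) \<le> (d + 1) * card (matchings (avoiding E (insert u U)))"
    using card_matchings_le_avoiding_vertex[OF finF] by (simp add: avoiding_avoiding)
  then have "(d + 1) ^ card U * card (matchings ?F)
      \<le> (d + 1) ^ card U * ((d + 1) * card (matchings (avoiding E (insert u U))))"
    by (rule mult_le_mono2)
  moreover have "card (matchings E) \<le> (d + 1) ^ card U * card (matchings ?F)"
    using insert.IH insert.prems by simp
  ultimately have "card (matchings E)
      \<le> (d + 1) ^ card U * ((d + 1) * card (matchings (avoiding E (insert u U))))"
    by (rule le_trans[rotated])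
  moreover have "card (insert u U) = Suc (card U)"
    using insert.hyps by simp
  ultimately show ?case
    by (simp only: power_Suc2 mult.assoc)
qed simp

lemma prob_uncovered_eq:
  assumes "finite E"
  shows "prob_uncovered E v = card (matchings (avoiding E {v})) / card (matchings E)"
proof -
  have "matchings E \<inter> {M. \<forall>e\<in>M. v \<notin> e} = matchings (avoiding E {v})"
    unfolding matchings_uncovered[symmetric] by auto
  then show ?thesis
    using assms by (simp add: prob_uncovered_def measure_pmf_of_set finite_matchings_edges
        matchings_nonempty)
qed

lemma prob_uncovered_lower_bound:
  assumes "finite E" "card {e\<in>E. v \<in> e} \<le> d"
  shows "1 / (real d + 1) \<le> prob_uncovered E v"
proof -
  have "real (card (matchings E)) \<le> (real d + 1) * card (matchings (avoiding E {v}))"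
    using card_matchings_le_avoiding_vertex[OF assms]
    by (metis of_nat_1 of_nat_add of_nat_le_iff of_nat_mult)
  then show ?thesis
    using card_matchings_pos[OF assms(1)] by (simp add: prob_uncovered_eq assms(1) field_simps)
qed

lemma prob_uncovered_upper_bound:
  assumes "finite V" "kgraph k V E" "regular_hypergraph d V E" "v \<in> V"
  shows "prob_uncovered E v \<le> 1 - real d / ((real d + 1) ^ (k - 1) + real d)"
proof -
  let ?Z = "card (matchings E)" and ?Zv = "card (matchings (avoiding E {v}))"
  let ?D = "{e\<in>E. v \<in> e}" and ?q = "(d + 1) ^ (k - 1)"
  have "E \<subseteq> Pow V" using assms(2) by (auto simp: kgraph_def)
  then have finE: "finite E" using assms(1) by (meson finite_Pow_iff finite_subset)
  have edge: "?Zv \<le> ?q * card (matchings (avoiding E e))" if "e \<in> ?D" for e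
  proof -
    have e: "e \<subseteq> V" "card e = k" using assms(2) that by (auto simp: kgraph_def)
    then have fine: "finite e" using assms(1) finite_subset by blast
    have deg: "card {f\<in>avoiding E {v}. u \<in> f} \<le> d" if "u \<in> e - {v}" for u
    proof -
      have "card {f\<in>avoiding E {v}. u \<in> f} \<le> card {f\<in>E. u \<in> f}"
        using finE avoiding_subset[of E "{v}"] by (intro card_mono) auto
      then show ?thesis using that e(1) assms(3) by (auto simp: regular_hypergraph_def)
    qed
    \<comment> \<open>Since \<open>v\<close> is already deleted, only the remaining
      \<open>k - 1\<close> vertices of \<open>e\<close> contribute a factor.\<close>
    have "?Zv \<le> (d + 1) ^ card (e - {v}) * card (matchings (avoiding (avoiding E {v}) (e - {v})))"
      using finE fine deg
      by (intro card_matchings_le_avoiding) (auto intro: finite_subset[OF avoiding_subset])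
    moreover have "{v} \<union> (e - {v}) = e" "card (e - {v}) = k - 1"
      using that e(2) fine by auto
    ultimately show ?thesis by (simp add: avoiding_avoiding)
  qed
  have "d * ?Zv = (\<Sum>e\<in>?D. ?Zv)"
    using assms(3,4) by (simp add: regular_hypergraph_def)
  also have "\<dots> \<le> (\<Sum>e\<in>?D. ?q * card (matchings (avoiding E e)))"
    by (intro sum_mono edge)
  also have "\<dots> = ?q * (\<Sum>e\<in>?D. card (matchings (avoiding E e)))"
    by (simp only: sum_distrib_left)
  \<comment> \<open>The split turns the sum into \<open>?Z - ?Zv\<close>; adding
    \<open>?q * ?Zv\<close> to both sides avoids subtraction on naturals.\<close>
  finally have "(?q + d) * ?Zv \<le> ?q * ?Z"
    using card_matchings_split_at_vertex[OF finE, of v] by (simp only: add_mult_distrib add_mult_distrib2)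
  then have "real ((?q + d) * ?Zv) \<le> real (?q * ?Z)"
    by (simp only: of_nat_le_iff)
  then have "((real d + 1) ^ (k - 1) + d) * ?Zv \<le> (real d + 1) ^ (k - 1) * ?Z"
    by (simp add: add.commute)
  moreover have "0 < (real d + 1) ^ (k - 1) + d"
    by (intro add_pos_nonneg) auto
  ultimately have "?Zv / ?Z \<le> (real d + 1) ^ (k - 1) / ((real d + 1) ^ (k - 1) + d)"
    using card_matchings_pos[OF finE] by (simp add: divide_simps mult.commute)
  also have "\<dots> = 1 - real d / ((real d + 1) ^ (k - 1) + d)"
    using \<open>0 < (real d + 1) ^ (k - 1) + d\<close> by (simp add: field_simps)
  finally show ?thesis by (simp add: prob_uncovered_eq finE)
qed

text \<open>After multiplication by \<open>d ^ (k - 2)\<close> the right-hand side tends to 1, which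
  exceeds \<open>1 - \<epsilon>\<close>.\<close>

lemma covered_bound_asymptotic:
  fixes k :: nat and \<epsilon> :: real
  assumes "k > 2" "\<epsilon> > 0"
  shows "\<forall>\<^sub>F d::nat in sequentially.
    (1 - \<epsilon>) / real d ^ (k - 2) < real d / ((real d + 1) ^ (k - 1) + real d)"
proof -
  \<comment> \<open>The exponents \<open>k - 1\<close> and \<open>k - 2\<close> become
    \<open>m + 2\<close> and \<open>m + 1\<close>. As \<open>m + 1\<close> is positive,
    \<open>(1 / d) ^ (m + 1)\<close> vanishes in the limit; this is where \<open>k > 2\<close>
    enters.\<close>
  obtain m where k: "k = m + 3"
    using assms(1)
    by (metis Suc_leI add.commute eval_nat_numeral(3) le_Suc_ex)
  have inv: "(\<lambda>d::nat. 1 / real d) \<longlonglongrightarrow> 0" by real_asymp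
  have "(\<lambda>d::nat. 1 / ((1 + 1 / real d) ^ (m + 2) + (1 / real d) ^ (m + 1)))
      \<longlonglongrightarrow> 1 / ((1 + 0) ^ (m + 2) + 0 ^ (m + 1))"
    by (intro tendsto_intros inv) auto
  then have "\<forall>\<^sub>F d::nat in sequentially.
      1 - \<epsilon> < 1 / ((1 + 1 / real d) ^ (m + 2) + (1 / real d) ^ (m + 1))"
    using assms(2) by (intro order_tendstoD(1)) auto
  then show ?thesis
    using eventually_gt_at_top[of 0]
  proof eventually_elim
    case (elim d)
    then have d: "real d > 0" by simp
    have "(1 + 1 / real d) ^ (m + 2) + (1 / real d) ^ (m + 1)
        = ((real d + 1) ^ (m + 2) + d) / real d ^ (m + 2)"
    proof -
      have "1 + 1 / real d = (real d + 1) / d" using d by (simp add: field_simps)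
      then have "(1 + 1 / real d) ^ (m + 2) = (real d + 1) ^ (m + 2) / real d ^ (m + 2)"
        by (simp only: power_divide)
      moreover have "(1 / real d) ^ (m + 1) = d / real d ^ (m + 2)"
        using d by (simp add: power_divide)
      ultimately show ?thesis by (simp only: add_divide_distrib)
    qed
    then have "1 - \<epsilon> < real d ^ (m + 2) / ((real d + 1) ^ (m + 2) + d)"
      using elim(1) by simp
    then have "(1 - \<epsilon>) / real d ^ (m + 1)
        < real d ^ (m + 2) / ((real d + 1) ^ (m + 2) + d) / real d ^ (m + 1)"
      using d by (intro divide_strict_right_mono) auto
    also have "\<dots> = real d / ((real d + 1) ^ (m + 2) + d)"
      using d by simp
    finally show ?case by (simp add: k)
  qed
qed

theorem theorem1p5:
  fixes k :: nat and \<epsilon> :: real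
  assumes "k > 2" and "\<epsilon> > 0"
  shows "\<exists>d0::nat. d0 > 0 \<and>
    (\<forall>d\<ge>d0. \<forall>(V :: 'a set) E v.
      finite V \<longrightarrow> kgraph k V E \<longrightarrow> linear_hypergraph E \<longrightarrow> regular_hypergraph d V E \<longrightarrow> v \<in> V \<longrightarrow>
        1 / (real d + 1) \<le> prob_uncovered E v \<and>
        prob_uncovered E v < 1 - (1 - \<epsilon>) / real d ^ (k - 2))"
proof -
  obtain d0 :: nat where d0:
    "\<And>d. d \<ge> d0 \<Longrightarrow> (1 - \<epsilon>) / real d ^ (k - 2) < real d / ((real d + 1) ^ (k - 1) + real d)"
    using covered_bound_asymptotic[OF assms] by (auto simp: eventually_sequentially)
  show ?thesis
  \<comment> \<open>The successor makes the threshold positive.\<close>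
  proof (intro exI[of _ "Suc d0"] conjI allI impI)
    fix d and V :: "'a set" and E v
    assume d: "Suc d0 \<le> d" and H: "finite V" "kgraph k V E" "regular_hypergraph d V E" "v \<in> V"
    have "E \<subseteq> Pow V" using H(2) by (auto simp: kgraph_def)
    then have "finite E" using H(1) by (meson finite_Pow_iff finite_subset)
    then show "1 / (real d + 1) \<le> prob_uncovered E v"
      using H(3,4) by (intro prob_uncovered_lower_bound) (auto simp: regular_hypergraph_def)
    show "prob_uncovered E v < 1 - (1 - \<epsilon>) / real d ^ (k - 2)"
      using prob_uncovered_upper_bound[OF H] d0[of d] d by simp
  qed simp
qed

end
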